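(* Let $k,m\in\mathbb{N}$ and $\alpha\in\mathbb{Q}$. If $0^{k}1^{m}(\alpha)=1$, then $$\alpha=\left[\frac{2}{3}\right]^m(2^k+1)-1,$$ and $\alpha\in\mathbb{N}$ if and only if there exists $l\in\mathbb{N}$ such that $k=(2l-1)3^{m-1}$.
   Context: $\mathbb{N}=\{1,2,3,\ldots\}$. The symbols $0$ and $1$, when used as letters in a word applied to a number, denote the maps $0:x\mapsto \frac{x}{2}$ and $1:x\mapsto\frac{3x+1}{2}$, here regarded as maps $\mathbb{Q}\to\mathbb{Q}$. Words denote compositions read from right to left (the rightmost letter is applied first), and $s^k$ denotes the $k$-fold composition of $s$ with itself; thus $0^k1^m(\alpha)$ means: apply the map $1$ exactly $m$ times to $\alpha$, then the map $0$ exactly $k$ times. Square brackets are ordinary parentheses. *)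

theory Defs
  imports Complex_Main
begin

definition letter0 :: "rat \<Rightarrow> rat" where
  "letter0 x = x / 2"

definition letter1 :: "rat \<Rightarrow> rat" where
  "letter1 x = (3 * x + 1) / 2"

end

(* The hypothesis says (3/2)^m (a + 1) = 2^k + 1, so a is a positive integer iff 3^m divides
   2^k + 1.  For y = 2^n with n odd, the second factor of y^3 + 1 = (y + 1) (y^2 - y + 1) is
   divisible by 3 exactly once; hence tripling an odd exponent raises the power of 3 in 2^n + 1
   by exactly one, while 9 divides 2^k + 1 only if 3 divides k. *)
theory Submission
  imports Defs
begin

lemma letter0_funpow: "(letter0 ^^ k) x = x / 2 ^ k"
  by (induction k) (simp_all add: letter0_def)

text \<open>In the shifted coordinate \<open>x + 1\<close> the map is multiplication by 3/2, since
  (3x + 1)/2 + 1 = 3(x + 1)/2.\<close>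

lemma letter1_funpow: "(letter1 ^^ m) x = (3 / 2) ^ m * (x + 1) - 1"
  by (induction m) (simp_all add: letter1_def field_simps)

lemma three_dvd_two_power_plus_one_iff: "(3::int) dvd 2 ^ k + 1 \<longleftrightarrow> odd k"
proof (induction k)
  case 0
  then show ?case
    by simp
next
  case (Suc k)
  have "\<not> (3::int) dvd 2 ^ k"
    using coprime_common_divisor [of "2 ^ k" "3::int" 3] by auto
  \<comment> \<open>Doubling swaps the residues 1 and 2 modulo 3, so divisibility alternates with
    the parity of \<open>k\<close>.\<close>
  moreover have "3 dvd 2 * x + 1 \<longleftrightarrow> \<not> 3 dvd x + 1" if "\<not> 3 dvd x" for x :: int
    using that by presburger
  ultimately show ?case
    using Suc.IH by simp
qed

text \<open>Since 8 is -1 modulo 9, \<open>2 ^ k\<close> is plus or minus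
  \<open>2 ^ (k mod 3)\<close>, and among 1, 2, 4 only 1 is congruent to 1 or -1.\<close>

lemma nine_dvd_two_power_plus_one:
  assumes "(9::int) dvd 2 ^ k + 1"
  shows "3 dvd k"
proof -
  have "(2::int) ^ k = 2 ^ (3 * (k div 3) + k mod 3)"
    by simp
  then have "(2::int) ^ k = 8 ^ (k div 3) * 2 ^ (k mod 3)"
    by (simp only: power_add power_mult) simp
  moreover have eight: "(8::int) ^ n mod 9 = 1 \<or> (8::int) ^ n mod 9 = 8" for n
  proof (induction n)
    case 0
    then show ?case
      by simp
  next
    case (Suc n)
    have "(8::int) ^ Suc n mod 9 = 8 * (8 ^ n mod 9) mod 9"
      by (simp add: mod_mult_right_eq)
    then show ?case
      using Suc.IH by auto
  qed
  moreover have "\<not> 9 dvd (8::int) ^ (k div 3) * r + 1" if "r = 2 \<or> r = 4" for r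
  proof -
    have "((8::int) ^ (k div 3) * r + 1) mod 9 = ((8 ^ (k div 3) mod 9) * r + 1) mod 9"
      by (intro mod_add_cong mod_mult_left_eq [symmetric] refl)
    \<comment> \<open>The possible residues are 3 and 8 for \<open>r = 2\<close>, and 5 and 6 for
      \<open>r = 4\<close>.\<close>
    also have "\<dots> \<noteq> 0"
      using that eight [of "k div 3"] by (elim disjE) simp_all
    finally show ?thesis
      by (simp only: dvd_eq_mod_eq_0 not_False_eq_True)
  qed
  ultimately have "(2::int) ^ (k mod 3) \<noteq> 2" and "(2::int) ^ (k mod 3) \<noteq> 4"
    using assms by metis+
  moreover have "k mod 3 = 0 \<or> k mod 3 = 1 \<or> k mod 3 = 2"
    by linarith
  ultimately have "k mod 3 = 0"
    by auto
  then show ?thesis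
    by (simp add: dvd_eq_mod_eq_0)
qed

lemma three_power_dvd_triple_exponent_iff:
  assumes "odd n"
  shows "(3::int) ^ Suc m dvd 2 ^ (n * 3) + 1 \<longleftrightarrow> 3 ^ m dvd (2::int) ^ n + 1"
proof -
  obtain c :: int where c: "2 ^ n + 1 = 3 * c"
    using assms three_dvd_two_power_plus_one_iff by blast
  define d where "d = 3 * c * (c - 1) + 1"
  have y: "2 ^ n = 3 * c - 1"
    using c by simp
  have "(2::int) ^ (n * 3) + 1 = 3 * ((2 ^ n + 1) * d)"
    unfolding power_mult y d_def by algebra
  moreover have "coprime d 3"
  proof -
    have "d - (c * (c - 1)) * 3 = 1"
      by (simp add: d_def)
    then show ?thesis
      by (intro coprimeI) (metis dvd_diff dvd_mult)
  qed
  then have "coprime (3 ^ m) d"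
    by (simp add: coprime_commute)
  ultimately show ?thesis
    by (simp add: coprime_dvd_mult_left_iff)
qed

text \<open>Induction on \<open>m\<close> with \<open>k\<close> free: the step trades
  \<open>k\<close> for \<open>k / 3\<close> and lowers the power of 3 by one.\<close>

lemma three_power_dvd_two_power_plus_one_iff:
  "(3::int) ^ Suc m dvd 2 ^ k + 1 \<longleftrightarrow> (\<exists>j. odd j \<and> k = j * 3 ^ m)"
proof (induction m arbitrary: k)
  case 0
  then show ?case
    using three_dvd_two_power_plus_one_iff by simp
next
  case (Suc m)
  show ?case
  proof
    assume dvd: "(3::int) ^ Suc (Suc m) dvd 2 ^ k + 1"
    have "(9::int) dvd 3 ^ Suc (Suc m)"
      by simp
    then obtain n where k: "k = n * 3"
      using dvd nine_dvd_two_power_plus_one by (metis dvd_trans dvd_div_mult_self)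
    \<comment> \<open>This makes \<open>k\<close>, and hence its divisor \<open>n\<close>, odd, as
      the passage from \<open>n\<close> to \<open>n * 3\<close> requires.\<close>
    have "(3::int) dvd 2 ^ k + 1"
      using dvd by (metis dvd_trans dvd_triv_left power_Suc)
    then have "odd n"
      using k three_dvd_two_power_plus_one_iff by simp
    then have "(3::int) ^ Suc m dvd 2 ^ n + 1"
      using dvd three_power_dvd_triple_exponent_iff [of n "Suc m"] unfolding k by blast
    then obtain j where "odd j" "n = j * 3 ^ m"
      using Suc.IH by blast
    then show "\<exists>j. odd j \<and> k = j * 3 ^ Suc m"
      using k by auto
  next
    assume "\<exists>j. odd j \<and> k = j * 3 ^ Suc m"
    then obtain j where j: "odd j" "k = j * 3 ^ m * 3"
      by auto
    then have "(3::int) ^ Suc m dvd 2 ^ (j * 3 ^ m) + 1"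
      using Suc.IH by blast
    then show "(3::int) ^ Suc (Suc m) dvd 2 ^ k + 1"
      using three_power_dvd_triple_exponent_iff [of "j * 3 ^ m" "Suc m"] j by simp
  qed
qed

text \<open>Powers of 2 and 3 are coprime, so only \<open>N\<close> can absorb the denominator
  \<open>3 ^ m\<close>.\<close>

lemma scaled_minus_one_pos_nat_iff:
  assumes "m \<ge> 1" and "N > 0"
  shows "((2 / 3) ^ m * of_int N - 1 :: rat) \<in> \<nat> - {0} \<longleftrightarrow> 3 ^ m dvd N"
proof
  assume "((2 / 3) ^ m * of_int N - 1 :: rat) \<in> \<nat> - {0}"
  then obtain a where "((2 / 3) ^ m * of_int N - 1 :: rat) = of_nat a"
    by (auto elim: Nats_cases)
  then have "(of_int (2 ^ m * N) :: rat) = of_int (3 ^ m * (int a + 1))"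
    by (simp add: field_simps)
  then have "2 ^ m * N = 3 ^ m * (int a + 1)"
    by (simp only: of_int_eq_iff)
  moreover have "coprime ((3::int) ^ m) (2 ^ m)"
    by simp
  ultimately show "3 ^ m dvd N"
    by (metis coprime_dvd_mult_right_iff dvd_triv_left)
next
  assume "3 ^ m dvd N"
  then obtain q where q: "N = 3 ^ m * q" ..
  then have "q \<ge> 1"
    using \<open>N > 0\<close> by (simp add: zero_less_mult_iff)
  \<comment> \<open>Here \<open>m \<ge> 1\<close> rules out the value 0: \<open>2 ^ m * q\<close> is
    at least 2, so subtracting 1 leaves a positive integer.\<close>
  moreover have "(2::int) ^ 1 \<le> 2 ^ m"
    using \<open>m \<ge> 1\<close> by (intro power_increasing) auto
  ultimately have "2 * 1 \<le> 2 ^ m * q"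
    by (intro mult_mono) auto
  moreover have "((2 / 3) ^ m * of_int N - 1 :: rat) = of_int (2 ^ m * q - 1)"
    by (simp add: q power_divide)
  moreover have "of_int z \<in> (\<nat> - {0} :: rat set)" if "z > 0" for z
    using that by (auto simp: Nats_altdef1)
  ultimately show "((2 / 3) ^ m * of_int N - 1 :: rat) \<in> \<nat> - {0}"
    by (simp del: of_int_diff of_int_mult of_int_power Diff_iff)
qed

theorem mainTheorem2:
  fixes k m :: nat and \<alpha> :: rat
  assumes "k \<ge> 1" and "m \<ge> 1"
    and "(letter0 ^^ k \<circ> letter1 ^^ m) \<alpha> = 1"
  shows "\<alpha> = (2 / 3) ^ m * (2 ^ k + 1) - 1 \<and>
    (\<alpha> \<in> \<nat> - {0} \<longleftrightarrow> (\<exists>l::nat. l \<ge> 1 \<and> k = (2 * l - 1) * 3 ^ (m - 1)))"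
proof -
  have "(3 / 2) ^ m * (\<alpha> + 1) = 2 ^ k + 1"
    using assms(3) by (simp add: letter0_funpow letter1_funpow field_simps)
  then have \<alpha>: "\<alpha> = (2 / 3) ^ m * (2 ^ k + 1) - 1"
    by (simp add: field_simps)
  have "\<alpha> \<in> \<nat> - {0} \<longleftrightarrow> (3::int) ^ m dvd 2 ^ k + 1"
    using scaled_minus_one_pos_nat_iff [OF \<open>m \<ge> 1\<close>, of "2 ^ k + 1"] \<alpha> by (simp add: add_pos_pos)
  also have "\<dots> \<longleftrightarrow> (\<exists>j. odd j \<and> k = j * 3 ^ (m - 1))"
    using three_power_dvd_two_power_plus_one_iff [of "m - 1" k] \<open>m \<ge> 1\<close> by simp
  also have "\<dots> \<longleftrightarrow> (\<exists>l::nat. l \<ge> 1 \<and> k = (2 * l - 1) * 3 ^ (m - 1))"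
  proof -
    \<comment> \<open>The bound \<open>l \<ge> 1\<close> keeps the truncated subtraction exact;
      \<open>l = 0\<close> would give the even value 0.\<close>
    have "odd j \<longleftrightarrow> (\<exists>l\<ge>1. j = 2 * l - 1)" for j :: nat
      by presburger
    then show ?thesis
      by (simp only:) blast
  qed
  finally show ?thesis
    using \<alpha> by blast
qed

end
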